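(* Let $X$ be a linear 2-normed space over the field $\mathbb{R}$, let $b\in X$ be fixed, and let $W$ be a subspace of $X$. Then each bounded b-linear functional $T_W$ defined on $W\times\langle b\rangle$ can be extended onto $X\times\langle b\rangle$ with preservation of the norm. In other words, there exists a bounded b-linear functional $T$ defined on $X\times\langle b\rangle$ such that $$T(x,b)=T_W(x,b)\ \text{ for all } x\in W,\qquad \|T_W\|=\|T\|.$$
   Context: Let $X$ be a linear space of dimension greater than $1$ over $\mathbb{K}$ ($\mathbb{R}$ or $\mathbb{C}$; here $\mathbb{K}=\mathbb{R}$). A 2-norm on $X$ is a function $\|\cdot,\cdot\|:X\times X\to\mathbb{R}$ such that: (N1) $\|x,y\|=0$ if and only if $x,y$ are linearly dependent; (N2) $\|x,y\|=\|y,x\|$; (N3) $\|\alpha x,y\|=|\alpha|\,\|x,y\|$ for all $\alpha\in\mathbb{K}$; (N4) $\|x,y+z\|\le\|x,y\|+\|x,z\|$. The pair $(X,\|\cdot,\cdot\|)$ is then called a linear 2-normed space. For fixed $b\in X$, $\langle b\rangle$ is the subspace of $X$ generated by $b$. For a subspace $W$ of $X$, a b-linear functional on $W\times\langle b\rangle$ is a map $T:W\times\langle b\rangle\to\mathbb{K}$ with $T(x+y,b)=T(x,b)+T(y,b)$ and $T(kx,b)=kT(x,b)$ for all $x,y\in W$, $k\in\mathbb{K}$. It is bounded if there is $M>0$ with $|T(x,b)|\le M\|x,b\|$ for all $x\in W$, and then $\|T\|=\inf\{M>0:|T(x,b)|\le M\|x,b\|\ \forall x\in W\}$. *)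

theory Defs
  imports Complex_Main "HOL-Library.FuncSet"
begin

text \<open>Linear dependence of the pair \<open>x, y\<close> as a family. The library predicate
  \<^const>\<open>dependent\<close> applied to the set \<open>{x, y}\<close> would not do, because this set
  collapses to a singleton when \<open>x = y\<close>.\<close>

definition linearly_dependent_pair :: "'a::real_vector \<Rightarrow> 'a \<Rightarrow> bool" where
  "linearly_dependent_pair x y \<longleftrightarrow>
     (\<exists>\<alpha> \<beta>::real. (\<alpha> \<noteq> 0 \<or> \<beta> \<noteq> 0) \<and> \<alpha> *\<^sub>R x + \<beta> *\<^sub>R y = 0)"

text \<open>The library function \<^const>\<open>dim\<close> is 0 on infinite-dimensional spaces, so that
  dimension greater than 1 is expressed by the size of a basis, which may be infinite.\<close>

definition dimension_gt_one :: "'a::real_vector itself \<Rightarrow> bool" where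
  "dimension_gt_one _ \<longleftrightarrow>
     (\<exists>B::'a set. independent B \<and> span B = UNIV \<and> (infinite B \<or> card B > 1))"

locale linear_2normed_space =
  fixes N :: "'a::real_vector \<Rightarrow> 'a \<Rightarrow> real"
  assumes dimension: "dimension_gt_one TYPE('a)"
    and N1: "N x y = 0 \<longleftrightarrow> linearly_dependent_pair x y"
    and N2: "N x y = N y x"
    and N3: "N (\<alpha> *\<^sub>R x) y = \<bar>\<alpha>\<bar> * N x y"
    and N4: "N x (y + z) \<le> N x y + N x z"

text \<open>A map on \<open>W \<times> \<langle>b\<rangle>\<close> is a function that takes the value \<^const>\<open>undefined\<close>
  outside this set. Linearity is only required at points with second component \<open>b\<close>.\<close>

definition b_linear_functional ::
    "'a::real_vector \<Rightarrow> 'a set \<Rightarrow> ('a \<times> 'a \<Rightarrow> real) \<Rightarrow> bool" where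
  "b_linear_functional b W T \<longleftrightarrow>
     T \<in> W \<times> span {b} \<rightarrow>\<^sub>E UNIV \<and>
     (\<forall>x\<in>W. \<forall>y\<in>W. T (x + y, b) = T (x, b) + T (y, b)) \<and>
     (\<forall>x\<in>W. \<forall>k::real. T (k *\<^sub>R x, b) = k * T (x, b))"

definition b_bounded ::
    "('a \<Rightarrow> 'a \<Rightarrow> real) \<Rightarrow> 'a \<Rightarrow> 'a set \<Rightarrow> ('a \<times> 'a \<Rightarrow> real) \<Rightarrow> bool" where
  "b_bounded N b W T \<longleftrightarrow> (\<exists>M>0. \<forall>x\<in>W. \<bar>T (x, b)\<bar> \<le> M * N x b)"

definition b_norm ::
    "('a \<Rightarrow> 'a \<Rightarrow> real) \<Rightarrow> 'a \<Rightarrow> 'a set \<Rightarrow> ('a \<times> 'a \<Rightarrow> real) \<Rightarrow> real" where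
  "b_norm N b W T = Inf {M. M > 0 \<and> (\<forall>x\<in>W. \<bar>T (x, b)\<bar> \<le> M * N x b)}"

end

(* Since N \<cdot> b is a seminorm, this is the Hahn-Banach theorem for the majorant
   \<parallel>T\<^sub>W\<parallel> N x b. A functional dominated by p is viewed as its graph, a subspace of
   X \<times> \<real> lying below the graph of p. Being single-valued is automatic for such subspaces,
   since p 0 = 0, and a maximal one is the graph of an everywhere defined functional. *)

theory Submission
  imports Defs "HOL-Analysis.Product_Vector"
begin

text \<open>This serves the Zorn argument: two points of the union lie in a common member, because
  any two members of a chain are comparable.\<close>

lemma subspace_Union_chain:
  assumes chain: "subset.chain A C" and "C \<noteq> {}"
    and sub: "\<And>G. G \<in> C \<Longrightarrow> subspace G"
  shows "subspace (\<Union>C)"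
proof (rule subspaceI)
  show "0 \<in> \<Union>C"
    using \<open>C \<noteq> {}\<close> sub subspace_0 by blast
  show "x + y \<in> \<Union>C" if "x \<in> \<Union>C" "y \<in> \<Union>C" for x y
  proof -
    from that obtain G H where GH: "G \<in> C" "H \<in> C" "x \<in> G" "y \<in> H"
      by blast
    then have "G \<subseteq> H \<or> H \<subseteq> G"
      using chain by (auto simp: subset_chain_def)
    then show ?thesis
      using GH sub subspace_add by blast
  qed
  show "c *\<^sub>R x \<in> \<Union>C" if "x \<in> \<Union>C" for c x
    using that sub subspace_scale by blast
qed

text \<open>Homogeneity includes the scalar 0 and thus yields \<open>p 0 = 0\<close>.\<close>

locale sublinear =
  fixes p :: "'a::real_vector \<Rightarrow> real"
  assumes subadd: "p (x + y) \<le> p x + p y"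
    and pos_hom: "0 \<le> t \<Longrightarrow> p (t *\<^sub>R x) = t * p x"
begin

definition dominated :: "('a \<times> real) set \<Rightarrow> bool" where
  "dominated G \<longleftrightarrow> subspace G \<and> (\<forall>(x, y)\<in>G. y \<le> p x)"

lemma dominated_subspace: "dominated G \<Longrightarrow> subspace G"
  by (simp add: dominated_def)

lemma dominated_le: "dominated G \<Longrightarrow> (x, y) \<in> G \<Longrightarrow> y \<le> p x"
  by (auto simp: dominated_def)

lemma dominated_unique:
  assumes G: "dominated G" and "(x, y) \<in> G" "(x, z) \<in> G"
  shows "y = z"
proof -
  have p0: "p 0 = 0"
    using pos_hom[of 0 0] by simp
  have le: "v \<le> w" if "(x, v) \<in> G" "(x, w) \<in> G" for v w
  proof -
    have "(0, v - w) \<in> G"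
      using subspace_diff[OF dominated_subspace[OF G] that] by simp
    from dominated_le[OF G this] show ?thesis
      by (simp add: p0)
  qed
  show ?thesis
    using le[of y z] le[of z y] assms by simp
qed

text \<open>One-dimensional extension step: the value \<open>c\<close> at \<open>x\<close> must lie
  above all \<open>s - p (u - x)\<close> and below all \<open>p (v + x) - t\<close>, with
  \<open>(u, s)\<close> and \<open>(v, t)\<close> in \<open>G\<close>. If \<open>G\<close> already
  has a point over \<open>x\<close>, then \<open>c\<close> is forced to be its value.\<close>

lemma dominated_extend:
  assumes G: "dominated G"
  obtains c where "dominated (span (insert (x, c) G))"
proof -
  note sub = dominated_subspace[OF G]
  have zero: "(0, 0) \<in> G"
    using subspace_0[OF sub] by (simp add: zero_prod_def)
  \<comment> \<open>Subadditivity for the splitting u + v = (u - x) + (v + x) separates the lower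
    from the upper constraints.\<close>
  have le: "s - p (u - x) \<le> p (v + x) - t" if "(u, s) \<in> G" "(v, t) \<in> G" for u s v t
  proof -
    have "(u + v, s + t) \<in> G"
      using subspace_add[OF sub that] by simp
    then have "s + t \<le> p (u + v)"
      by (rule dominated_le[OF G])
    also have "\<dots> \<le> p (u - x) + p (v + x)"
      using subadd[of "u - x" "v + x"] by simp
    finally show ?thesis
      by simp
  qed
  \<comment> \<open>The least admissible value is taken. The supremum is finite, since by
    \<open>le\<close> the point (0, 0) of \<open>G\<close> gives the upper bound
    \<open>p x\<close>.\<close>
  define c where "c = (SUP (u, s)\<in>G. s - p (u - x))"
  have lower: "s - p (u - x) \<le> c" if "(u, s) \<in> G" for u s
  proof -
    have "bdd_above ((\<lambda>(u, s). s - p (u - x)) ` G)"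
      using le[OF _ zero] by (intro bdd_aboveI[where M = "p (0 + x) - 0"]) auto
    from cSUP_upper[OF that this] show ?thesis
      by (simp add: c_def)
  qed
  have upper: "c \<le> p (v + x) - t" if "(v, t) \<in> G" for v t
    unfolding c_def using zero le[OF _ that] by (intro cSUP_least) auto
  have "s \<le> p u" if "(u, s) \<in> span (insert (x, c) G)" for u s
  proof -
    from that obtain k where "(u, s) - k *\<^sub>R (x, c) \<in> span G"
      unfolding span_breakdown_eq by blast
    then have k: "(u - k *\<^sub>R x, s - k * c) \<in> G"
      by (simp add: span_eq_iff[THEN iffD2, OF sub])
    have scaled: "(l *\<^sub>R (u - k *\<^sub>R x), l * (s - k * c)) \<in> G" for l
      using subspace_scale[OF sub k, of l] by simp
    consider "k = 0" | "k > 0" | "k < 0"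
      by linarith
    then show ?thesis
    proof cases
      case 1
      then show ?thesis
        using dominated_le[OF G k] by simp
    next
      case 2
      \<comment> \<open>Rescaling by 1/k gives the point (u/k - x, s/k - c) of \<open>G\<close>, so
        the \<open>x\<close> inside \<open>p\<close> cancels in the upper constraint.\<close>
      have "c \<le> p ((1 / k) *\<^sub>R u) - (s / k - c)"
        using upper[OF scaled[of "1 / k"]] 2
        by (simp add: scaleR_diff_right diff_divide_distrib)
      then show ?thesis
        using 2 by (simp add: pos_hom field_simps)
    next
      case 3
      \<comment> \<open>The positive factor is now -1/k, which turns the summand -x into +x, so the
        lower constraint applies.\<close>
      have "- (s / k) + c - p ((- (1 / k)) *\<^sub>R u) \<le> c"
        using lower[OF scaled[of "- (1 / k)"]] 3
        by (simp add: scaleR_diff_right diff_divide_distrib)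
      moreover have "p ((- (1 / k)) *\<^sub>R u) = - (1 / k) * p u"
        using 3 by (intro pos_hom) simp
      ultimately have "- (s / k) \<le> - (p u / k)"
        by simp
      then show ?thesis
        using 3 by (simp add: divide_le_cancel)
    qed
  qed
  then have "dominated (span (insert (x, c) G))"
    by (auto simp: dominated_def)
  then show thesis
    by (rule that)
qed

theorem hahn_banach:
  fixes f :: "'a \<Rightarrow> real"
  assumes W: "subspace W"
    and add: "\<And>x y. x \<in> W \<Longrightarrow> y \<in> W \<Longrightarrow> f (x + y) = f x + f y"
    and hom: "\<And>k x. x \<in> W \<Longrightarrow> f (k *\<^sub>R x) = k * f x"
    and le: "\<And>x. x \<in> W \<Longrightarrow> f x \<le> p x"
  obtains g where "linear g" "\<And>x. x \<in> W \<Longrightarrow> g x = f x" "\<And>x. g x \<le> p x"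
proof -
  define F where "F = (\<lambda>x. (x, f x)) ` W"
  have F: "dominated F"
    unfolding dominated_def
  proof
    show "subspace F"
    proof (rule subspaceI)
      show "0 \<in> F"
        using subspace_0[OF W] hom[of 0 0] by (auto simp: F_def zero_prod_def image_iff)
    qed (auto simp: F_def image_iff add hom subspace_add[OF W] subspace_scale[OF W])
    show "\<forall>(x, y)\<in>F. y \<le> p x"
      using le by (auto simp: F_def)
  qed
  let ?A = "{G. dominated G \<and> F \<subseteq> G}"
  have "\<exists>M\<in>?A. \<forall>X\<in>?A. M \<subseteq> X \<longrightarrow> X = M"
  proof (rule subset_Zorn_nonempty)
    show "?A \<noteq> {}"
      using F by blast
    fix C assume C: "C \<noteq> {}" "subset.chain ?A C"
    then have CA: "C \<subseteq> ?A"
      by (simp add: subset_chain_def)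
    then have "subspace (\<Union>C)"
      using subspace_Union_chain[OF C(2,1)] dominated_subspace by blast
    then have "dominated (\<Union>C)"
      using CA by (auto simp: dominated_def)
    then show "\<Union>C \<in> ?A"
      using CA C(1) by blast
  qed
  then obtain G where G: "dominated G" "F \<subseteq> G"
    and max: "\<And>X. dominated X \<Longrightarrow> G \<subseteq> X \<Longrightarrow> X = G"
    by (smt (verit) mem_Collect_eq subset_trans)
  \<comment> \<open>By maximality the extension at \<open>x\<close> equals \<open>G\<close>, which
    therefore already contains a point over \<open>x\<close>.\<close>
  have "\<exists>c. (x, c) \<in> G" for x
  proof -
    obtain c where c: "dominated (span (insert (x, c) G))"
      using dominated_extend[OF G(1)] .
    have "insert (x, c) G \<subseteq> span (insert (x, c) G)"
      by (rule span_superset)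
    then show ?thesis
      using max[OF c] by blast
  qed
  then obtain g where g: "\<And>x. (x, g x) \<in> G"
    by metis
  \<comment> \<open>Here \<open>unique\<close> turns a membership \<open>(x, z) \<in> G\<close> into
    \<open>g x = z\<close>, so linearity of \<open>g\<close> is closure of \<open>G\<close> under
    the operations.\<close>
  note sub = dominated_subspace[OF G(1)] and unique = dominated_unique[OF G(1) g]
  show thesis
  proof
    show "linear g"
    proof (rule linearI)
      show "g (x + y) = g x + g y" for x y
        using subspace_add[OF sub g g, of x y] by (intro unique) simp
      show "g (k *\<^sub>R x) = k *\<^sub>R g x" for k x
        using subspace_scale[OF sub g, of k x] by (intro unique) simp
    qed
    show "g x = f x" if "x \<in> W" for x
      using that G(2) by (intro unique) (auto simp: F_def)
    show "g x \<le> p x" for x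
      using dominated_le[OF G(1) g] .
  qed
qed

end

context linear_2normed_space
begin

text \<open>Since x + (-x) = 0, the triangle inequality bounds 0 by twice
  \<open>N x y\<close>.\<close>

lemma nonneg: "0 \<le> N x y"
proof -
  have "N y 0 = 0"
    using N3[of 0 0 y] N2 by simp
  moreover have "N y (- x) = N x y"
    using N3[of "- 1" x y] by (simp add: N2)
  ultimately show ?thesis
    using N4[of y x "- x"] by (simp add: N2)
qed

lemma b_norm_nonneg:
  assumes "b_bounded N b W T"
  shows "0 \<le> b_norm N b W T"
  using assms unfolding b_norm_def b_bounded_def by (intro cInf_greatest) auto

text \<open>The infimum is itself a valid bound: if \<open>N x b\<close> is positive, every
  admissible M is at least the quotient of the two sides; if it is 0, any admissible M forces
  \<open>T (x, b) = 0\<close>.\<close>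

lemma b_norm_bound:
  assumes "b_bounded N b W T" "x \<in> W"
  shows "\<bar>T (x, b)\<bar> \<le> b_norm N b W T * N x b"
proof (cases "N x b = 0")
  case True
  then show ?thesis
    using assms unfolding b_bounded_def by force
next
  case False
  then have pos: "0 < N x b"
    using nonneg[of x b] by simp
  have "\<bar>T (x, b)\<bar> / N x b \<le> b_norm N b W T"
    using assms pos unfolding b_norm_def b_bounded_def
    by (intro cInf_greatest) (auto simp: divide_le_eq)
  then show ?thesis
    using pos by (simp add: divide_le_eq)
qed

lemma b_norm_least:
  assumes "0 < M" "\<And>x. x \<in> W \<Longrightarrow> \<bar>T (x, b)\<bar> \<le> M * N x b"
  shows "b_norm N b W T \<le> M"
  using assms unfolding b_norm_def by (intro cInf_lower bdd_belowI[where m = 0]) auto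

end

theorem theorem5p10:
  fixes N :: "'a::real_vector \<Rightarrow> 'a \<Rightarrow> real"
    and b :: 'a
    and W :: "'a set"
    and T\<^sub>W :: "'a \<times> 'a \<Rightarrow> real"
  assumes "linear_2normed_space N"
    and "subspace W"
    and "b_linear_functional b W T\<^sub>W"
    and "b_bounded N b W T\<^sub>W"
  shows "\<exists>T. b_linear_functional b UNIV T \<and> b_bounded N b UNIV T \<and>
           (\<forall>x\<in>W. T (x, b) = T\<^sub>W (x, b)) \<and>
           b_norm N b W T\<^sub>W = b_norm N b UNIV T"
proof -
  interpret linear_2normed_space N
    by fact
  define m where "m = b_norm N b W T\<^sub>W"
  have m: "0 \<le> m"
    unfolding m_def using assms(4) by (rule b_norm_nonneg)
  interpret sublinear "\<lambda>x. m * N x b"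
  proof
    show "m * N (x + y) b \<le> m * N x b + m * N y b" for x y
      using mult_left_mono[OF N4[of b x y] m] by (simp add: N2[of b] distrib_left)
  qed (simp add: N3)
  have "T\<^sub>W (x, b) \<le> m * N x b" if "x \<in> W" for x
    using b_norm_bound[OF assms(4) that] by (simp add: m_def)
  moreover have "T\<^sub>W (x + y, b) = T\<^sub>W (x, b) + T\<^sub>W (y, b)" if "x \<in> W" "y \<in> W" for x y
    using assms(3) that by (simp add: b_linear_functional_def)
  moreover have "T\<^sub>W (k *\<^sub>R x, b) = k * T\<^sub>W (x, b)" if "x \<in> W" for k x
    using assms(3) that by (simp add: b_linear_functional_def)
  ultimately obtain g where g: "linear g" "\<And>x. x \<in> W \<Longrightarrow> g x = T\<^sub>W (x, b)"
    and g_le: "\<And>x. g x \<le> m * N x b"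
    using hahn_banach[OF assms(2), of "\<lambda>x. T\<^sub>W (x, b)"] by blast
  \<comment> \<open>The one-sided bound suffices because the majorant is even and \<open>g\<close>
    is odd.\<close>
  have g_abs: "\<bar>g x\<bar> \<le> m * N x b" for x
    using g_le[of x] g_le[of "- x"] N3[of "- 1" x b] linear_neg[OF g(1), of x] by simp
  \<comment> \<open>\<open>T\<close> ignores its second argument on its domain; the restriction
    makes it \<open>undefined\<close> elsewhere, as the extensional function space demands.\<close>
  define T where "T = restrict (\<lambda>(x, c). g x) (UNIV \<times> span {b})"
  have T: "T (x, b) = g x" for x
    by (simp add: T_def span_base)
  \<comment> \<open>Both functionals admit the same positive bounds, which gives boundedness of
    \<open>T\<close> and equality of the infima. Comparing all M > 0 also covers
    \<open>m = 0\<close>, where \<open>m\<close> itself is not among the admissible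
    constants.\<close>
  have bound_iff: "(\<forall>x\<in>W. \<bar>T\<^sub>W (x, b)\<bar> \<le> M * N x b) \<longleftrightarrow> (\<forall>x\<in>UNIV. \<bar>T (x, b)\<bar> \<le> M * N x b)"
    if "0 < M" for M
  proof
    assume "\<forall>x\<in>W. \<bar>T\<^sub>W (x, b)\<bar> \<le> M * N x b"
    then have "m \<le> M"
      unfolding m_def using that by (intro b_norm_least) auto
    then have "m * N x b \<le> M * N x b" for x
      using nonneg by (rule mult_right_mono)
    then show "\<forall>x\<in>UNIV. \<bar>T (x, b)\<bar> \<le> M * N x b"
      using g_abs order_trans unfolding T by blast
  qed (metis T UNIV_I g(2))
  have "b_linear_functional b UNIV T"
    unfolding b_linear_functional_def T
    using linear_add[OF g(1)] linear_scale[OF g(1)] by (simp add: T_def)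
  moreover have "b_bounded N b UNIV T"
    using assms(4) bound_iff unfolding b_bounded_def by blast
  moreover have "b_norm N b W T\<^sub>W = b_norm N b UNIV T"
    unfolding b_norm_def using bound_iff by (intro arg_cong[where f = Inf]) blast
  ultimately show ?thesis
    using g(2) T by metis
qed

end
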